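(* Let $\varphi_q$ be a timelike trajectory ruled surface of type $M_+^1$ in Minkowski 3-space and let the spacelike trajectory ruled surface $\varphi_{q_1}$ of type $M_+^2$ be a Mannheim offset of $\varphi_q$. If $\varphi_q$ and $\varphi_{q_1}$ are both developable, then their striction lines are Mannheim partner curves in Minkowski 3-space.
   Context: Minkowski 3-space is $\mathbb{R}^3$ with $\langle \vec a,\vec b\rangle=-a_1b_1+a_2b_2+a_3b_3$ and Lorentzian cross product $\vec a\times\vec b=(a_2b_3-a_3b_2,\;a_1b_3-a_3b_1,\;a_2b_1-a_1b_2)$. A vector is spacelike if $\langle \vec a,\vec a\rangle>0$ or $\vec a=0$, and timelike if $\langle \vec a,\vec a\rangle<0$; $\|\vec a\|=\sqrt{|\langle\vec a,\vec a\rangle|}$. A ruled surface is $\varphi(s,v)=\vec k(s)+v\,\vec q(s)$ with $\vec q$ a unit vector. Its striction line is $\vec c(s)=\vec k(s)-\dfrac{\langle d\vec q/ds,\,d\vec k/ds\rangle}{\langle d\vec q/ds,\,d\vec q/ds\rangle}\,\vec q(s)$, and its distribution parameter is $\delta=\dfrac{\det(d\vec k/ds,\vec q,d\vec q/ds)}{\langle d\vec q/ds,d\vec q/ds\rangle}$. The surface is developable if $\delta=0$ at all points. Its frame consists of $\vec q$, the central normal $\vec h=\dfrac{d\vec q/ds}{\|d\vec q/ds\|}$ and the asymptotic normal $\vec a$, orthogonal to both, placed at the striction point of each ruling; all frame vectors and their derivatives are assumed non-null. The surface is of type $M_+^1$ if $\vec q$ and $\vec h$ are both spacelike (it is then timelike,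 and $\vec a=\vec q\times\vec h$ is timelike), and of type $M_+^2$ if $\vec q$ is spacelike and $\vec h$ is timelike (it is then spacelike). Dual numbers are $\bar\lambda=\lambda+\varepsilon\lambda^*$ with $\varepsilon\ne0$, $\varepsilon^2=0$, and real functions are extended by $f(x+\varepsilon x^* )=f(x)+\varepsilon x^*f'(x)$. By E. Study's mapping, a directed non-null line with unit direction $\vec x$ and moment vector $\vec x^*$ is represented by the dual unit vector $\tilde x=\vec x+\varepsilon\vec x^*$. Write $\tilde q,\tilde h,\tilde a$ for the dual unit vectors of the directed lines through the striction point with directions $\vec q,\vec h,\vec a$; equivalently $\tilde h=d\tilde q/\|d\tilde q\|$, with $\tilde a$ orthogonal to $\tilde q$ and $\tilde h$. The ruled surface $\varphi_{q_1}$ with dual frame $\{\tilde q_1(s_1),\tilde h_1(s_1),\tilde a_1(s_1)\}$ is a Mannheim offset of $\varphi_q$ with dual frame $\{\tilde q(s),\tilde h(s),\tilde a(s)\}$ if $\tilde a(s)=\tilde h_1(s_1)$ at corresponding parameters, where $s,s_1$ are the arc-lengths of the striction lines of $\varphi_q,\varphi_{q_1}$. In that case $\varphi_{q_1}$ is of type $M_+^2$, and $\tilde q_1=\cos\bar\theta\,\tilde q+\sin\bar\theta\,\tilde h$, $\tilde h_1=\tilde a$, $\tilde a_1=\sin\bar\theta\,\tilde q-\cos\bar\theta\,\tilde h$, where $\bar\theta=\theta+\varepsilon\theta^*$ is the dual offset angle; the striction lines $\vec\alpha$ of $\varphi_q$ and $\vec\beta$ of $\varphi_{q_1}$ are related by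 $\vec\beta(s)=\vec\alpha(s)+\theta^*\vec a(s)$. Mannheim partner curves: for two space curves $C$ and $C^*$, $C$ is a Mannheim partner curve of $C^*$ if there is a one-to-one correspondence between their points such that, at corresponding points, the binormal vector of $C$ is the principal normal vector of $C^*$. Here $C$ is the striction line $\vec\alpha$ of $\varphi_q$ and $C^*$ is the striction line $\vec\beta$ of $\varphi_{q_1}$. *)

theory Defs
  imports "HOL-Analysis.Analysis"
begin

section \<open>Minkowski 3-space\<close>

definition lor :: "real^3 \<Rightarrow> real^3 \<Rightarrow> real" where
  "lor a b = - (a$1 * b$1) + a$2 * b$2 + a$3 * b$3"

definition lcross :: "real^3 \<Rightarrow> real^3 \<Rightarrow> real^3" where
  "lcross a b = vector [a$2 * b$3 - a$3 * b$2, a$1 * b$3 - a$3 * b$1, a$2 * b$1 - a$1 * b$2]"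

definition spacelike :: "real^3 \<Rightarrow> bool" where
  "spacelike a \<longleftrightarrow> lor a a > 0 \<or> a = 0"

definition timelike :: "real^3 \<Rightarrow> bool" where
  "timelike a \<longleftrightarrow> lor a a < 0"

definition nonnull :: "real^3 \<Rightarrow> bool" where
  "nonnull a \<longleftrightarrow> spacelike a \<or> timelike a"

definition lnorm :: "real^3 \<Rightarrow> real" where
  "lnorm a = sqrt \<bar>lor a a\<bar>"


section \<open>Curves\<close>

definition vderiv :: "(real \<Rightarrow> 'a::real_normed_vector) \<Rightarrow> real \<Rightarrow> 'a" where
  "vderiv f t = vector_derivative f (at t)"

definition smooth_curve_on :: "real set \<Rightarrow> (real \<Rightarrow> 'a::real_normed_vector) \<Rightarrow> bool" where
  "smooth_curve_on I f \<longleftrightarrow>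
     (\<exists>D. D 0 = f \<and> (\<forall>n. \<forall>t\<in>I. (D n has_vector_derivative D (Suc n) t) (at t)))"

definition open_interval :: "real set \<Rightarrow> bool" where
  "open_interval I \<longleftrightarrow> open I \<and> is_interval I \<and> I \<noteq> {}"

definition arc_length_on :: "real set \<Rightarrow> (real \<Rightarrow> real^3) \<Rightarrow> bool" where
  "arc_length_on I c \<longleftrightarrow> (\<forall>t\<in>I. lnorm (vderiv c t) = 1)"

text \<open>The following Frenet vectors are meant for arc-length parametrized curves.\<close>

definition tangent :: "(real \<Rightarrow> real^3) \<Rightarrow> real \<Rightarrow> real^3" where
  "tangent c t = vderiv c t"

definition principal_normal :: "(real \<Rightarrow> real^3) \<Rightarrow> real \<Rightarrow> real^3" where
  "principal_normal c t = vderiv (tangent c) t /\<^sub>R lnorm (vderiv (tangent c) t)"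

definition binormal :: "(real \<Rightarrow> real^3) \<Rightarrow> real \<Rightarrow> real^3" where
  "binormal c t = lcross (tangent c t) (principal_normal c t)"

definition frenet_curve_on :: "real set \<Rightarrow> (real \<Rightarrow> real^3) \<Rightarrow> bool" where
  "frenet_curve_on I c \<longleftrightarrow> open_interval I \<and> smooth_curve_on I c \<and> arc_length_on I c \<and>
     (\<forall>t\<in>I. lor (vderiv (tangent c) t) (vderiv (tangent c) t) \<noteq> 0)"

definition reparametrization :: "(real \<Rightarrow> real) \<Rightarrow> real set \<Rightarrow> real set \<Rightarrow> bool" where
  "reparametrization u J I \<longleftrightarrow> open_interval J \<and> bij_betw u J I \<and>
     smooth_curve_on J u \<and> (\<forall>t\<in>J. vderiv u t \<noteq> 0)"

text \<open>
  \<open>C\<close> (given by \<open>c\<close> on \<open>I\<close>) is a Mannheim partner curve of \<open>C\<^sup>*\<close> (given by \<open>d\<close> on \<open>J\<close>) with respect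
  to the correspondence \<open>\<psi>\<close> of their points. The curves carry no preferred orientation, and the
  binormal changes its sign when a curve is traversed backwards; hence the Frenet vectors are those
  of suitable arc-length parametrizations \<open>c \<circ> u\<close> and \<open>d \<circ> w\<close>, each chosen once for the whole curve.
  The points with parameters \<open>s\<close> and \<open>t\<close> correspond to each other iff \<open>w t = \<psi> (u s)\<close>.
\<close>

definition mannheim_partner ::
  "(real \<Rightarrow> real) \<Rightarrow> real set \<Rightarrow> (real \<Rightarrow> real^3) \<Rightarrow> real set \<Rightarrow> (real \<Rightarrow> real^3) \<Rightarrow> bool" where
  "mannheim_partner \<psi> I c J d \<longleftrightarrow> bij_betw \<psi> I J \<and>
     (\<exists>u I' w J'. reparametrization u I' I \<and> reparametrization w J' J \<and>
        frenet_curve_on I' (c \<circ> u) \<and> frenet_curve_on J' (d \<circ> w) \<and>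
        (\<forall>s\<in>I'. \<forall>t\<in>J'. w t = \<psi> (u s) \<longrightarrow> binormal (c \<circ> u) s = principal_normal (d \<circ> w) t))"


section \<open>Ruled surfaces\<close>

text \<open>The ruled surface \<open>\<phi>(s,v) = k(s) + v q(s)\<close>, with \<open>s\<close> in an interval, is given by \<open>k\<close> and \<open>q\<close>.\<close>

definition striction_line :: "(real \<Rightarrow> real^3) \<Rightarrow> (real \<Rightarrow> real^3) \<Rightarrow> real \<Rightarrow> real^3" where
  "striction_line k q s =
     k s - (lor (vderiv q s) (vderiv k s) / lor (vderiv q s) (vderiv q s)) *\<^sub>R q s"

definition distribution_parameter :: "(real \<Rightarrow> real^3) \<Rightarrow> (real \<Rightarrow> real^3) \<Rightarrow> real \<Rightarrow> real" where
  "distribution_parameter k q s =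
     det (vector [vderiv k s, q s, vderiv q s] :: real^3^3) / lor (vderiv q s) (vderiv q s)"

definition developable :: "real set \<Rightarrow> (real \<Rightarrow> real^3) \<Rightarrow> (real \<Rightarrow> real^3) \<Rightarrow> bool" where
  "developable I k q \<longleftrightarrow> (\<forall>s\<in>I. distribution_parameter k q s = 0)"

definition central_normal :: "(real \<Rightarrow> real^3) \<Rightarrow> real \<Rightarrow> real^3" where
  "central_normal q s = vderiv q s /\<^sub>R lnorm (vderiv q s)"

text \<open>
  For timelike \<open>h\<close> the orientation is the one of \<open>a\<^sub>1 = sin \<theta> q - cos \<theta> h\<close> in the frame
  \<open>q\<^sub>1 = cos \<theta> q + sin \<theta> h\<close>, \<open>h\<^sub>1 = a = q \<times> h\<close> of a Mannheim offset, that is \<open>a\<^sub>1 = h\<^sub>1 \<times> q\<^sub>1\<close>.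
\<close>

definition asymptotic_normal :: "(real \<Rightarrow> real^3) \<Rightarrow> real \<Rightarrow> real^3" where
  "asymptotic_normal q s =
     (if timelike (central_normal q s) then lcross (central_normal q s) (q s)
      else lcross (q s) (central_normal q s))"

definition ruled_surface :: "real set \<Rightarrow> (real \<Rightarrow> real^3) \<Rightarrow> (real \<Rightarrow> real^3) \<Rightarrow> bool" where
  "ruled_surface I k q \<longleftrightarrow> open_interval I \<and> smooth_curve_on I k \<and> smooth_curve_on I q \<and>
     (\<forall>s\<in>I. lnorm (q s) = 1 \<and> vderiv q s \<noteq> 0 \<and>
       (\<forall>f\<in>{q, central_normal q, asymptotic_normal q}. nonnull (f s) \<and> nonnull (vderiv f s)))"

definition type_M1_plus :: "real set \<Rightarrow> (real \<Rightarrow> real^3) \<Rightarrow> bool" where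
  "type_M1_plus I q \<longleftrightarrow> (\<forall>s\<in>I. spacelike (q s) \<and> spacelike (central_normal q s))"

definition type_M2_plus :: "real set \<Rightarrow> (real \<Rightarrow> real^3) \<Rightarrow> bool" where
  "type_M2_plus I q \<longleftrightarrow> (\<forall>s\<in>I. spacelike (q s) \<and> timelike (central_normal q s))"


section \<open>Dual vectors and Mannheim offsets\<close>

text \<open>\<open>DualVec x y\<close> is the dual vector \<open>x + \<epsilon> y\<close>.\<close>

datatype dual_vec = DualVec (real_part: "real^3") (dual_part: "real^3")

text \<open>E. Study's mapping for the directed line through \<open>p\<close> with unit direction \<open>x\<close>.\<close>

definition study :: "real^3 \<Rightarrow> real^3 \<Rightarrow> dual_vec" where
  "study p x = DualVec x (lcross p x)"

definition dual_central_normal ::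
  "(real \<Rightarrow> real^3) \<Rightarrow> (real \<Rightarrow> real^3) \<Rightarrow> real \<Rightarrow> dual_vec" where
  "dual_central_normal k q s = study (striction_line k q s) (central_normal q s)"

definition dual_asymptotic_normal ::
  "(real \<Rightarrow> real^3) \<Rightarrow> (real \<Rightarrow> real^3) \<Rightarrow> real \<Rightarrow> dual_vec" where
  "dual_asymptotic_normal k q s = study (striction_line k q s) (asymptotic_normal q s)"

text \<open>
  The surface \<open>(k\<^sub>1, q\<^sub>1)\<close> is a Mannheim offset of \<open>(k, q)\<close> with respect to the correspondence
  \<open>s\<^sub>1 = \<psi> s\<close> of the arc-length parameters of the two striction lines.
\<close>

definition mannheim_offset ::
  "(real \<Rightarrow> real) \<Rightarrow> real set \<Rightarrow> (real \<Rightarrow> real^3) \<Rightarrow> (real \<Rightarrow> real^3) \<Rightarrow>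
   real set \<Rightarrow> (real \<Rightarrow> real^3) \<Rightarrow> (real \<Rightarrow> real^3) \<Rightarrow> bool" where
  "mannheim_offset \<psi> I k q I1 k1 q1 \<longleftrightarrow>
     arc_length_on I (striction_line k q) \<and> arc_length_on I1 (striction_line k1 q1) \<and>
     bij_betw \<psi> I I1 \<and>
     (\<forall>s\<in>I. dual_asymptotic_normal k q s = dual_central_normal k1 q1 (\<psi> s))"

end

theory Submission
  imports Defs
begin

text \<open>
  Developability puts the derivative of the striction line into the span of \<open>q\<close> and \<open>q'\<close>, while the
  striction condition makes it orthogonal to \<open>q'\<close>. With arc-length parametrization it is therefore
  \<open>\<sigma> q\<close> with a sign \<open>\<sigma>\<close>, which is constant by connectedness. Hence the Frenet frame of the striction
  line is \<open>(q, h, a)\<close> up to signs, and \<open>a = h\<^sub>1\<close> says that the binormal of the first striction line is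
  the principal normal of the second one up to a constant sign, which is absorbed by orienting the
  first curve suitably.
\<close>

section \<open>Algebra of the Lorentzian form and cross product\<close>

text \<open>One source for the algebraic rules \<open>lor_simps\<close>, for continuity, and for the
  product rule when the form is differentiated along curves.\<close>

lemma bounded_bilinear_lor: "bounded_bilinear lor"
proof -
  have "bilinear lor"
    unfolding bilinear_def lor_def
    by (auto intro!: linearI simp: algebra_simps)
  then show ?thesis
    by (simp add: bilinear_conv_bounded_bilinear)
qed

lemmas lor_simps =
  bounded_bilinear.add_left [OF bounded_bilinear_lor]
  bounded_bilinear.add_right [OF bounded_bilinear_lor]
  bounded_bilinear.diff_left [OF bounded_bilinear_lor]
  bounded_bilinear.diff_right [OF bounded_bilinear_lor]
  bounded_bilinear.scaleR_left [OF bounded_bilinear_lor]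
  bounded_bilinear.scaleR_right [OF bounded_bilinear_lor]

lemma lor_commute: "lor x y = lor y x"
  by (simp add: lor_def)

lemma lnorm_scaleR: "lnorm (c *\<^sub>R x) = \<bar>c\<bar> * lnorm x"
  by (simp add: lnorm_def lor_simps abs_mult real_sqrt_mult)

lemma lcross_scaleR: "lcross (a *\<^sub>R x) (b *\<^sub>R y) = (a * b) *\<^sub>R lcross x y"
  by (simp add: lcross_def vec_eq_iff forall_3 algebra_simps)

text \<open>\<open>lcross\<close> is the Euclidean cross product with its last two components
  negated, and \<open>lor\<close> negates the first product, so all three terms of the determinant
  change sign.\<close>

lemma det_eq_lor_lcross: "det (vector [x, y, z] :: real^3^3) = - lor x (lcross y z)"
  by (simp add: det_3 lor_def lcross_def algebra_simps)

lemma lor_self_eq_1: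
  assumes "spacelike x" "lnorm x = 1"
  shows "lor x x = 1"
  using assms by (auto simp: spacelike_def lnorm_def lor_def)

lemma lor_self_nonzero: "nonnull x \<Longrightarrow> x \<noteq> 0 \<Longrightarrow> lor x x \<noteq> 0"
  by (auto simp: nonnull_def spacelike_def timelike_def)

text \<open>Coordinates of \<open>y\<close> with respect to \<open>q\<close>, \<open>p\<close> and
  their cross product, by Cramer's rule for the Gram matrix of \<open>q\<close> and
  \<open>p\<close>. The cross product is orthogonal to both, and its square is minus the Gram
  determinant. With the denominator cleared this is a polynomial identity, valid also in degenerate
  cases.\<close>

lemma lor_gram_expansion:
  "(lor q q * lor p p - (lor q p)\<^sup>2) *\<^sub>R y =
     (lor y q * lor p p - lor y p * lor q p) *\<^sub>R q
     + (lor y p * lor q q - lor y q * lor q p) *\<^sub>R p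
     - lor y (lcross q p) *\<^sub>R lcross q p"
  by (simp add: vec_eq_iff forall_3 lor_def lcross_def power2_eq_square algebra_simps)

text \<open>In the Gram expansion the component along \<open>p\<close> vanishes by orthogonality,
  the one along the cross product because it is the determinant up to sign.\<close>

lemma parallel_of_det_eq_0:
  assumes "det (vector [x, q, p] :: real^3^3) = 0"
    and "lor q q = 1" "lor q p = 0" "lor p p \<noteq> 0" "lor x p = 0"
  shows "x = lor x q *\<^sub>R q"
proof -
  have "lor p p *\<^sub>R x = lor p p *\<^sub>R (lor x q *\<^sub>R q)"
    using lor_gram_expansion[of q p x] assms by (simp add: det_eq_lor_lcross mult.commute)
  then show ?thesis
    using assms(4) by (metis scaleR_left_imp_eq)
qed

section \<open>Smooth curves and reversal of orientation\<close>

lemma vderiv_eq: "(f has_vector_derivative d) (at t) \<Longrightarrow> vderiv f t = d"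
  by (simp add: vderiv_def vector_derivative_at)

lemma smooth_curve_on_has_vderiv:
  assumes "smooth_curve_on I f" "t \<in> I"
  shows "(f has_vector_derivative vderiv f t) (at t)"
  using assms unfolding smooth_curve_on_def by (metis vderiv_eq)

lemma smooth_curve_on_if_has_vector_derivative:
  assumes "smooth_curve_on I g" "\<And>t. t \<in> I \<Longrightarrow> (f has_vector_derivative g t) (at t)"
  shows "smooth_curve_on I f"
proof -
  obtain D where "D 0 = g" "\<And>n t. t \<in> I \<Longrightarrow> (D n has_vector_derivative D (Suc n) t) (at t)"
    using assms(1) unfolding smooth_curve_on_def by blast
  then show ?thesis
    unfolding smooth_curve_on_def using assms(2)
    by (intro exI[of _ "case_nat f D"]) (auto split: nat.split)
qed

text \<open>Each differentiation contributes one factor \<open>c\<close>, which gives the whole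
  tower of derivatives explicitly.\<close>

lemma smooth_curve_on_scaleR_compose_mult:
  fixes g :: "real \<Rightarrow> 'a::real_normed_vector"
  assumes "smooth_curve_on I g"
  shows "smooth_curve_on {t. c * t \<in> I} (\<lambda>t. a *\<^sub>R g (c * t))"
proof -
  obtain D where D: "D 0 = g" "\<And>n t. t \<in> I \<Longrightarrow> (D n has_vector_derivative D (Suc n) t) (at t)"
    using assms unfolding smooth_curve_on_def by blast
  have "((\<lambda>t. (a * c ^ n) *\<^sub>R D n (c * t)) has_vector_derivative
          (a * c ^ Suc n) *\<^sub>R D (Suc n) (c * t)) (at t)" if "c * t \<in> I" for n t
  proof -
    have "((\<lambda>t. c * t) has_vector_derivative c) (at t)"
      by (auto intro!: derivative_eq_intros)
    from vector_diff_chain_at[OF this D(2)[OF that, of n]]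
    have "((\<lambda>t. D n (c * t)) has_vector_derivative c *\<^sub>R D (Suc n) (c * t)) (at t)"
      by (simp add: o_def)
    from bounded_linear.has_vector_derivative[OF bounded_linear_scaleR_right this, of "a * c ^ n"]
    show ?thesis
      by (simp add: ac_simps)
  qed
  then show ?thesis
    unfolding smooth_curve_on_def
    by (intro exI[of _ "\<lambda>n t. (a * c ^ n) *\<^sub>R D n (c * t)"]) (simp add: D(1))
qed

lemma open_interval_vimage_sign:
  assumes "open_interval I" "\<rho> \<in> {1, -1}"
  shows "open_interval {t. \<rho> * t \<in> I}"
proof -
  have "{t. - t \<in> I} = uminus ` I"
    by force
  then have "{t. \<rho> * t \<in> I} = I \<or> {t. \<rho> * t \<in> I} = uminus ` I"
    using assms(2) by auto
  moreover have "open (uminus ` I)" "is_interval (uminus ` I)" "uminus ` I \<noteq> {}"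
    using assms(1) by (auto simp: open_interval_def open_negations)
  ultimately show ?thesis
    using assms(1) by (auto simp: open_interval_def)
qed

lemma reparametrization_sign:
  assumes "open_interval I" "\<rho> \<in> {1, -1}"
  shows "reparametrization (\<lambda>t. \<rho> * t) {t. \<rho> * t \<in> I} I"
proof -
  have der: "((\<lambda>t. \<rho> * t) has_vector_derivative \<rho>) (at t)" for t
    by (auto intro!: derivative_eq_intros)
  have "smooth_curve_on {t. \<rho> * t \<in> I} (\<lambda>t. \<rho>)"
    unfolding smooth_curve_on_def
    by (rule exI[of _ "\<lambda>n t. if n = 0 then \<rho> else 0"]) auto
  then have "smooth_curve_on {t. \<rho> * t \<in> I} (\<lambda>t. \<rho> * t)"
    using der by (rule smooth_curve_on_if_has_vector_derivative)
  moreover have "bij_betw (\<lambda>t. \<rho> * t) {t. \<rho> * t \<in> I} I"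
    \<comment> \<open>Multiplication by a sign is its own inverse.\<close>
    using assms(2) by (intro bij_betwI[where g = "\<lambda>t. \<rho> * t"]) auto
  ultimately show ?thesis
    using assms(2) open_interval_vimage_sign[OF assms] vderiv_eq[OF der]
    unfolding reparametrization_def by fastforce
qed

section \<open>Derivatives of striction lines\<close>

text \<open>Orthogonality comes from differentiating \<open>lor q q = 1\<close>. Since
  \<open>nonnull\<close> admits the zero vector, the last claim also uses that the derivative of
  \<open>q\<close> does not vanish.\<close>

lemma ruled_surface_lor_director:
  assumes "ruled_surface I k q" "\<And>s. s \<in> I \<Longrightarrow> spacelike (q s)" "s \<in> I"
  shows "lor (q s) (q s) = 1" "lor (q s) (vderiv q s) = 0" "lor (vderiv q s) (vderiv q s) \<noteq> 0"
proof -
  have unit: "lor (q t) (q t) = 1" if "t \<in> I" for t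
    using assms that by (auto simp: ruled_surface_def intro: lor_self_eq_1)
  then show "lor (q s) (q s) = 1"
    using assms(3) by blast
  have q': "(q has_vector_derivative vderiv q s) (at s)"
    using assms by (auto simp: ruled_surface_def intro: smooth_curve_on_has_vderiv)
  have "((\<lambda>t. lor (q t) (q t)) has_vector_derivative
          lor (q s) (vderiv q s) + lor (vderiv q s) (q s)) (at s)"
    by (rule bounded_bilinear.has_vector_derivative[OF bounded_bilinear_lor q' q'])
  moreover have "((\<lambda>t. lor (q t) (q t)) has_vector_derivative 0) (at s)"
    by (rule has_vector_derivative_transform_within_open[of "\<lambda>t. 1" _ _ I])
      (use assms unit in \<open>auto simp: ruled_surface_def open_interval_def\<close>)
  ultimately show "lor (q s) (vderiv q s) = 0"
    using vector_derivative_unique_at lor_commute[of "q s"] by fastforce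
  show "lor (vderiv q s) (vderiv q s) \<noteq> 0"
    using assms(1,3) by (intro lor_self_nonzero) (auto simp: ruled_surface_def)
qed

text \<open>Product and quotient rule; \<open>f\<close> is the coefficient of \<open>q\<close> in
  the striction line. Its derivative \<open>f'\<close> is exported as a continuous function because
  a continuity argument later fixes a sign on all of \<open>I\<close>.\<close>

lemma striction_line_has_derivative:
  assumes "ruled_surface I k q" "\<And>s. s \<in> I \<Longrightarrow> spacelike (q s)"
  obtains f' f where "continuous_on I f'"
    "\<And>s. s \<in> I \<Longrightarrow> f s = lor (vderiv q s) (vderiv k s) / lor (vderiv q s) (vderiv q s)"
    "\<And>s. s \<in> I \<Longrightarrow> (striction_line k q has_vector_derivative
        vderiv k s - (f s *\<^sub>R vderiv q s + f' s *\<^sub>R q s)) (at s)"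
proof -
  have "open I"
    using assms(1) by (simp add: ruled_surface_def open_interval_def)
  obtain K where K: "K 0 = k" "\<And>n t. t \<in> I \<Longrightarrow> (K n has_vector_derivative K (Suc n) t) (at t)"
    using assms(1) unfolding ruled_surface_def smooth_curve_on_def by blast
  obtain Q where Q: "Q 0 = q" "\<And>n t. t \<in> I \<Longrightarrow> (Q n has_vector_derivative Q (Suc n) t) (at t)"
    using assms(1) unfolding ruled_surface_def smooth_curve_on_def by blast
  have k': "vderiv k t = K 1 t" and q': "vderiv q t = Q 1 t" if "t \<in> I" for t
    using K Q that by (metis One_nat_def vderiv_eq)+
  have cont: "continuous_on I (K n)" "continuous_on I (Q n)" for n
    using K(2) Q(2)
    by (meson continuous_at_imp_continuous_on has_vector_derivative_continuous)+
  \<comment> \<open>Numerator and denominator of the striction coefficient, written with the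
    derivative towers; these agree with \<open>vderiv\<close> on \<open>I\<close>, and their second
    derivatives are continuous there.\<close>
  define N M where "N t = lor (Q 1 t) (K 1 t)" and "M t = lor (Q 1 t) (Q 1 t)" for t
  define N' M' where "N' t = lor (Q 1 t) (K 2 t) + lor (Q 2 t) (K 1 t)"
    and "M' t = lor (Q 1 t) (Q 2 t) + lor (Q 2 t) (Q 1 t)" for t
  define f' where "f' t = (N' t * M t - N t * M' t) / (M t * M t)" for t
  have M: "M t \<noteq> 0" if "t \<in> I" for t
    using ruled_surface_lor_director(3)[OF assms that] q'[OF that] by (simp add: M_def)
  have "continuous_on I N" "continuous_on I M" "continuous_on I N'" "continuous_on I M'"
    unfolding N_def M_def N'_def M'_def
    by (intro continuous_on_add bounded_bilinear.continuous_on[OF bounded_bilinear_lor] cont)+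
  then have "continuous_on I f'"
    unfolding f'_def using M by (intro continuous_intros) auto
  moreover have "(striction_line k q has_vector_derivative
        vderiv k s - ((N s / M s) *\<^sub>R vderiv q s + f' s *\<^sub>R q s)) (at s)" if s: "s \<in> I" for s
  proof -
    have "(N has_vector_derivative N' s) (at s)" "(M has_vector_derivative M' s) (at s)"
      unfolding N_def M_def N'_def M'_def using K(2)[OF s, of 1] Q(2)[OF s, of 1]
      by (auto intro!: bounded_bilinear.has_vector_derivative[OF bounded_bilinear_lor]
          simp: numeral_2_eq_2)
    then have "((\<lambda>t. N t / M t) has_real_derivative f' s) (at s)"
      unfolding f'_def using M[OF s]
      by (intro DERIV_divide) (auto simp: has_real_derivative_iff_has_vector_derivative)
    moreover have "(q has_vector_derivative Q 1 s) (at s)" "(k has_vector_derivative K 1 s) (at s)"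
      using K(2)[OF s, of 0] Q(2)[OF s, of 0] K(1) Q(1) by auto
    ultimately have "((\<lambda>t. k t - (N t / M t) *\<^sub>R q t) has_vector_derivative
        K 1 s - ((N s / M s) *\<^sub>R Q 1 s + f' s *\<^sub>R q s)) (at s)"
      by (intro has_vector_derivative_diff has_vector_derivative_scaleR)
    then show ?thesis
      unfolding k'[OF s] q'[OF s]
      by (rule has_vector_derivative_transform_within_open[OF _ \<open>open I\<close> s])
        (simp add: striction_line_def k' q' N_def M_def)
  qed
  ultimately show thesis
    using that[of f' "\<lambda>t. N t / M t"] by (simp add: N_def M_def k' q')
qed

text \<open>The sign must be the same for all rulings, since the Frenet frames are later oriented
  once for the whole curve.\<close>

lemma developable_striction_line_derivative:
  assumes "ruled_surface I k q" "\<And>s. s \<in> I \<Longrightarrow> spacelike (q s)"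
    and "developable I k q" "arc_length_on I (striction_line k q)"
  obtains \<sigma> :: real where "\<sigma> \<in> {1, -1}"
    "\<And>s. s \<in> I \<Longrightarrow> (striction_line k q has_vector_derivative \<sigma> *\<^sub>R q s) (at s)"
proof -
  obtain f' f where cont: "continuous_on I f'"
    and f: "\<And>s. s \<in> I \<Longrightarrow> f s = lor (vderiv q s) (vderiv k s) / lor (vderiv q s) (vderiv q s)"
    and c': "\<And>s. s \<in> I \<Longrightarrow> (striction_line k q has_vector_derivative
        vderiv k s - (f s *\<^sub>R vderiv q s + f' s *\<^sub>R q s)) (at s)"
    by (rule striction_line_has_derivative[OF assms(1,2)]) (assumption, rule that)
  \<comment> \<open>The component along \<open>q\<close> of the derivative of the striction line:
    \<open>q\<close> is a unit vector and its derivative is orthogonal to it.\<close>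
  define L where "L s = lor (vderiv k s) (q s) - f' s" for s
  have deriv: "(striction_line k q has_vector_derivative L s *\<^sub>R q s) (at s)"
    and sign: "L s \<in> {1, -1}" if s: "s \<in> I" for s
  proof -
    note lor = ruled_surface_lor_director[OF assms(1,2) s]
    define x where "x = vderiv k s - (f s *\<^sub>R vderiv q s + f' s *\<^sub>R q s)"
    have "det (vector [vderiv k s, q s, vderiv q s] :: real^3^3) = 0"
      using assms(3) s lor(3) by (auto simp: developable_def distribution_parameter_def)
    \<comment> \<open>Subtracting multiples of the other two rows from the first row keeps the
      determinant zero.\<close>
    moreover have "lor (q s) (lcross (q s) (vderiv q s)) = 0"
      "lor (vderiv q s) (lcross (q s) (vderiv q s)) = 0"
      by (simp_all add: lor_def lcross_def algebra_simps)
    ultimately have "det (vector [x, q s, vderiv q s] :: real^3^3) = 0"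
      by (simp add: det_eq_lor_lcross x_def lor_simps)
    \<comment> \<open>The coefficient \<open>f\<close> of the striction line is exactly the one that
      achieves this.\<close>
    moreover have "lor x (vderiv q s) = 0"
      using lor(2,3) f[OF s] by (simp add: x_def lor_simps lor_commute)
    moreover have "lor x (q s) = L s"
      using lor(1,2) by (simp add: x_def L_def lor_simps lor_commute)
    ultimately have x: "x = L s *\<^sub>R q s"
      using parallel_of_det_eq_0[of x "q s" "vderiv q s"] lor by simp
    then show d: "(striction_line k q has_vector_derivative L s *\<^sub>R q s) (at s)"
      using c'[OF s] by (simp add: x_def)
    have "lnorm (L s *\<^sub>R q s) = 1"
      using assms(4) s vderiv_eq[OF d] by (auto simp: arc_length_on_def)
    then have "\<bar>L s\<bar> = 1"
      using lor(1) by (simp add: lnorm_scaleR) (simp add: lnorm_def)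
    then show "L s \<in> {1, -1}"
      by auto
  qed
  have "continuous_on I (vderiv k)"
  proof -
    obtain D where D: "D 0 = k" "\<And>n t. t \<in> I \<Longrightarrow> (D n has_vector_derivative D (Suc n) t) (at t)"
      using assms(1) unfolding ruled_surface_def smooth_curve_on_def by blast
    have "continuous_on I (D 1)"
      using D(2) by (meson continuous_at_imp_continuous_on has_vector_derivative_continuous)
    moreover have "vderiv k t = D 1 t" if "t \<in> I" for t
      using D that by (metis One_nat_def vderiv_eq)
    ultimately show ?thesis
      using continuous_on_cong by metis
  qed
  moreover have "continuous_on I q"
    using assms(1) smooth_curve_on_has_vderiv[of I q]
    by (meson ruled_surface_def continuous_at_imp_continuous_on has_vector_derivative_continuous)
  ultimately have "continuous_on I L"
    unfolding L_def using cont
    by (intro continuous_on_diff bounded_bilinear.continuous_on[OF bounded_bilinear_lor])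
  moreover have "connected I"
    using assms(1) by (simp add: ruled_surface_def open_interval_def is_interval_connected)
  \<comment> \<open>A continuous function with finitely many values on a connected set is
    constant.\<close>
  moreover have "finite (L ` I)"
    by (rule finite_subset[of _ "{1, -1}"]) (use sign in auto)
  ultimately have "L constant_on I"
    by (intro continuous_finite_range_constant)
  then obtain \<sigma> where \<sigma>: "\<And>s. s \<in> I \<Longrightarrow> L s = \<sigma>"
    by (auto simp: constant_on_def)
  obtain s0 where "s0 \<in> I"
    using assms(1) by (auto simp: ruled_surface_def open_interval_def)
  then show thesis
    using that[of \<sigma>] \<sigma> sign deriv by metis
qed

section \<open>Frenet frames of the striction lines\<close>

text \<open>The tangent carries the sign \<open>\<sigma> * \<rho>\<close>. Differentiating once more
  adds a second \<open>\<rho>\<close>, which cancels, so the normal carries \<open>\<sigma>\<close>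
  alone and the binormal \<open>\<rho>\<close> alone. Reversing the curve thus changes the binormal
  but not the principal normal.\<close>

lemma frenet_frame_of_unit_derivative:
  fixes c q :: "real \<Rightarrow> real^3"
  assumes "open_interval I" "smooth_curve_on I q"
    and unit: "\<And>s. s \<in> I \<Longrightarrow> lnorm (q s) = 1"
    and nonnull: "\<And>s. s \<in> I \<Longrightarrow> lor (vderiv q s) (vderiv q s) \<noteq> 0"
    and \<sigma>: "\<sigma> \<in> {1, -1}" and \<rho>: "\<rho> \<in> {1, -1}"
    and c': "\<And>s. s \<in> I \<Longrightarrow> (c has_vector_derivative \<sigma> *\<^sub>R q s) (at s)"
  defines "J \<equiv> {t. \<rho> * t \<in> I}" and "u \<equiv> (\<lambda>t. \<rho> * t)"
  shows "frenet_curve_on J (c \<circ> u)"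
    and "t \<in> J \<Longrightarrow> principal_normal (c \<circ> u) t = \<sigma> *\<^sub>R central_normal q (u t)"
    and "t \<in> J \<Longrightarrow> binormal (c \<circ> u) t = \<rho> *\<^sub>R lcross (q (u t)) (central_normal q (u t))"
proof -
  have J: "open_interval J"
    unfolding J_def using assms(1) \<rho> by (rule open_interval_vimage_sign)
  have u': "(u has_vector_derivative \<rho>) (at t)" for t
    unfolding u_def by (auto intro!: derivative_eq_intros)
  have squares: "\<sigma> * \<sigma> = 1" "\<rho> * \<rho> = 1" and abs: "\<bar>\<sigma>\<bar> = 1" "\<bar>\<rho>\<bar> = 1"
    using \<sigma> \<rho> by auto
  have cu': "((c \<circ> u) has_vector_derivative (\<sigma> * \<rho>) *\<^sub>R q (u t)) (at t)" if "t \<in> J" for t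
    using vector_diff_chain_at[OF u' c'[of "u t"]] that
    by (simp add: J_def u_def mult.commute)
  then have tangent: "tangent (c \<circ> u) t = (\<sigma> * \<rho>) *\<^sub>R q (u t)" if "t \<in> J" for t
    using that by (simp add: tangent_def vderiv_eq)
  have tangent': "vderiv (tangent (c \<circ> u)) t = \<sigma> *\<^sub>R vderiv q (u t)" if "t \<in> J" for t
  proof (rule vderiv_eq)
    have "(q has_vector_derivative vderiv q (u t)) (at (u t))"
      using assms(2) that by (auto simp: J_def u_def intro: smooth_curve_on_has_vderiv)
    from vector_diff_chain_at[OF u' this]
    have "((\<lambda>t. q (u t)) has_vector_derivative \<rho> *\<^sub>R vderiv q (u t)) (at t)"
      by (simp add: o_def)
    from bounded_linear.has_vector_derivative[OF bounded_linear_scaleR_right this, of "\<sigma> * \<rho>"]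
    have "((\<lambda>t. (\<sigma> * \<rho>) *\<^sub>R q (u t)) has_vector_derivative \<sigma> *\<^sub>R vderiv q (u t)) (at t)"
      by (simp add: squares mult.assoc)
    then show "(tangent (c \<circ> u) has_vector_derivative \<sigma> *\<^sub>R vderiv q (u t)) (at t)"
      \<comment> \<open>The formula for the tangent is known only on \<open>J\<close>, which
        suffices because \<open>J\<close> is open.\<close>
      by (rule has_vector_derivative_transform_within_open[where S = J])
        (use J that tangent in \<open>auto simp: open_interval_def\<close>)
  qed
  have "smooth_curve_on J (\<lambda>t. (\<sigma> * \<rho>) *\<^sub>R q (u t))"
    unfolding J_def u_def using assms(2) by (rule smooth_curve_on_scaleR_compose_mult)
  then have "smooth_curve_on J (c \<circ> u)"
    using cu' by (rule smooth_curve_on_if_has_vector_derivative)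
  moreover have "arc_length_on J (c \<circ> u)"
    using unit abs vderiv_eq[OF cu']
    by (simp add: arc_length_on_def lnorm_scaleR abs_mult J_def u_def)
  ultimately show "frenet_curve_on J (c \<circ> u)"
    using J nonnull squares
    by (simp add: frenet_curve_on_def tangent' lor_simps) (auto simp: J_def u_def)
  show normal: "principal_normal (c \<circ> u) t = \<sigma> *\<^sub>R central_normal q (u t)" if "t \<in> J" for t
    using that abs by (simp add: principal_normal_def tangent' central_normal_def lnorm_scaleR)
  show "binormal (c \<circ> u) t = \<rho> *\<^sub>R lcross (q (u t)) (central_normal q (u t))" if "t \<in> J" for t
    using that squares
    by (simp add: binormal_def tangent normal lcross_scaleR mult.commute mult.left_commute)
qed

theorem theorem4p3:
  fixes I I1 :: "real set"
    and k q k1 q1 :: "real \<Rightarrow> real^3"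
    and \<psi> :: "real \<Rightarrow> real"
  assumes "ruled_surface I k q"
    and "ruled_surface I1 k1 q1"
    and "type_M1_plus I q"
    and "type_M2_plus I1 q1"
    and "mannheim_offset \<psi> I k q I1 k1 q1"
    and "developable I k q"
    and "developable I1 k1 q1"
  shows "mannheim_partner \<psi> I (striction_line k q) I1 (striction_line k1 q1)"
proof -
  have spacelike: "\<And>s. s \<in> I \<Longrightarrow> spacelike (q s)" "\<And>s. s \<in> I1 \<Longrightarrow> spacelike (q1 s)"
    using assms(3,4) by (auto simp: type_M1_plus_def type_M2_plus_def)
  have arc: "arc_length_on I (striction_line k q)" "arc_length_on I1 (striction_line k1 q1)"
    and bij: "bij_betw \<psi> I I1"
    using assms(5) by (auto simp: mannheim_offset_def)
  have normals: "lcross (q s) (central_normal q s) = central_normal q1 (\<psi> s)" if "s \<in> I" for s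
  proof -
    \<comment> \<open>Comparison of the real parts of the two dual unit vectors.\<close>
    have "asymptotic_normal q s = central_normal q1 (\<psi> s)"
      using assms(5) that
      by (auto simp: mannheim_offset_def dual_asymptotic_normal_def dual_central_normal_def study_def)
    moreover have "\<not> timelike (central_normal q s)"
      using assms(3) that by (auto simp: type_M1_plus_def spacelike_def timelike_def lor_def)
    ultimately show ?thesis
      by (simp add: asymptotic_normal_def)
  qed
  obtain \<sigma> where \<sigma>: "\<sigma> \<in> {1, -1}"
    and c': "\<And>s. s \<in> I \<Longrightarrow> (striction_line k q has_vector_derivative \<sigma> *\<^sub>R q s) (at s)"
    using developable_striction_line_derivative[OF assms(1) spacelike(1) assms(6) arc(1)] by blast
  obtain \<sigma>1 where \<sigma>1: "\<sigma>1 \<in> {1, -1}"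
    and c1': "\<And>s. s \<in> I1 \<Longrightarrow> (striction_line k1 q1 has_vector_derivative \<sigma>1 *\<^sub>R q1 s) (at s)"
    using developable_striction_line_derivative[OF assms(2) spacelike(2) assms(7) arc(2)] by blast
  have I: "open_interval I" "smooth_curve_on I q" "\<And>s. s \<in> I \<Longrightarrow> lnorm (q s) = 1"
    using assms(1) by (auto simp: ruled_surface_def)
  have I1: "open_interval I1" "smooth_curve_on I1 q1" "\<And>s. s \<in> I1 \<Longrightarrow> lnorm (q1 s) = 1"
    using assms(2) by (auto simp: ruled_surface_def)
  have one: "(1::real) \<in> {1, -1}"
    by simp
  \<comment> \<open>The first curve is traversed with orientation \<open>\<rho> = \<sigma>1\<close>,
    so that its binormal gets the sign carried by the principal normal of the second curve, which
    keeps its orientation.\<close>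
  note frame = frenet_frame_of_unit_derivative
    [OF I ruled_surface_lor_director(3)[OF assms(1) spacelike(1)] \<sigma> \<sigma>1 c']
  note frame1 = frenet_frame_of_unit_derivative
    [OF I1 ruled_surface_lor_director(3)[OF assms(2) spacelike(2)] \<sigma>1 one c1']
  show ?thesis
    unfolding mannheim_partner_def
  proof (intro conjI bij exI ballI impI)
    \<comment> \<open>The \<open>exI\<close> steps leave the witnesses schematic; this fact and the
      next \<open>reparametrization\<close> fact instantiate them. The factor \<open>1\<close> is
      written out so that the second witness has the shape supplied by
      \<open>frame1\<close>.\<close>
    show "reparametrization (\<lambda>t. \<sigma>1 * t) {t. \<sigma>1 * t \<in> I} I"
      using I(1) \<sigma>1 by (rule reparametrization_sign)
    show "reparametrization (\<lambda>t. 1 * t) {t. 1 * t \<in> I1} I1"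
      using I1(1) one by (rule reparametrization_sign)
    show "frenet_curve_on {t. \<sigma>1 * t \<in> I} (striction_line k q \<circ> (\<lambda>t. \<sigma>1 * t))"
      by (rule frame(1))
    show "frenet_curve_on {t. 1 * t \<in> I1} (striction_line k1 q1 \<circ> (\<lambda>t. 1 * t))"
      by (rule frame1(1))
    fix s t
    assume s: "s \<in> {t. \<sigma>1 * t \<in> I}" and t: "t \<in> {t. 1 * t \<in> I1}"
      and corresponding: "1 * t = \<psi> (\<sigma>1 * s)"
    have "binormal (striction_line k q \<circ> (\<lambda>t. \<sigma>1 * t)) s =
        \<sigma>1 *\<^sub>R lcross (q (\<sigma>1 * s)) (central_normal q (\<sigma>1 * s))"
      using s by (intro frame(3))
    also have "\<dots> = \<sigma>1 *\<^sub>R central_normal q1 (1 * t)"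
      using normals s corresponding by simp
    also have "\<dots> = principal_normal (striction_line k1 q1 \<circ> (\<lambda>t. 1 * t)) t"
      using t by (intro frame1(2)[symmetric])
    finally show "binormal (striction_line k q \<circ> (\<lambda>t. \<sigma>1 * t)) s =
        principal_normal (striction_line k1 q1 \<circ> (\<lambda>t. 1 * t)) t" .
  qed
qed

end
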